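(* Let $B = B_1\oplus B_2$ be a layered braid diagram with layers $B_1$, $B_2$. Then the determinant of the OU matrix of $B$ is the product of the determinants of the OU matrices of $B_1$ and $B_2$: $$\det(B_1\oplus B_2)=\det(B_1)\det(B_2).$$
   Context: An $n$-braid diagram $B$ ($n\ge 1$) is the planar diagram of a braid on $n$ strands, given by a word in $\sigma_1^{\pm1},\dots,\sigma_{n-1}^{\pm1}$ read from top to bottom; $\sigma_k$ (a positive crossing) is a crossing of the strands currently at positions $k$ and $k+1$ in which the strand going from position $k$ to position $k+1$ passes under the other, and $\sigma_k^{-1}$ is the same with the other strand passing under. The strands are labelled $s_1,\dots,s_n$ from left to right at the top. A strand permutation $\pi$ of $\{1,\dots,n\}$ corresponds to the sequence of strands $\mathbf{s}=(s_{\pi(1)},\dots,s_{\pi(n)})$. The OU (over-under) matrix $M(B_{\mathbf{s}})=M_B(\pi)$ is the $n\times n$ matrix with zero diagonal whose $(i,j)$-entry for $i\neq j$ is the number of crossings of $B$ at which $s_{\pi(i)}$ passes over $s_{\pi(j)}$. Its determinant does not depend on $\pi$ and is denoted $\det(B)$. For strands $s_i\ne s_j$, $\mathrm{wd}(s_i,s_j)$ is the number of crossings at which $s_i$ is under $s_j$. $B$ is layered with layers $B_1,B_2$, written $B=B_1\oplus B_2$, if its set of strands is a disjoint union $S_1\amalg S_2$ of two non-empty sets with $\mathrm{wd}(s_i,s_j)=0$ for all $s_i\in S_1$, $s_j\in S_2$, and $B_l$ is the $\#(S_l)$-braid diagram formed by the strands of $B$ in $S_l$ (all other strands deleted, disregarding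 the exact positions of endpoints), $l=1,2$. *)

theory Defs
  imports "Jordan_Normal_Form.Determinant"
begin

(* Sigma k and Sigma_inv k stand for sigma_k and sigma_k^{-1}; positions and strands are
   numbered 1, ..., n. *)
datatype braid_letter = Sigma nat | Sigma_inv nat

fun pos_of :: "braid_letter \<Rightarrow> nat" where
  "pos_of (Sigma k) = k"
| "pos_of (Sigma_inv k) = k"

datatype braid = Braid (width: nat) (letters: "braid_letter list")

definition braid_diagram :: "braid \<Rightarrow> bool" where
  "braid_diagram B \<longleftrightarrow>
     width B \<ge> 1 \<and> (\<forall>c\<in>set (letters B). 1 \<le> pos_of c \<and> pos_of c < width B)"

(* An arrangement p maps each position to the label of the strand that is currently there. *)
definition cross_at :: "nat \<Rightarrow> (nat \<Rightarrow> nat) \<Rightarrow> nat \<Rightarrow> nat" where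
  "cross_at k p = p \<circ> Transposition.transpose k (Suc k)"

(* At sigma_k the strand p k moves from position k to position k + 1 and passes under
   p (k + 1). *)
fun over_under :: "(nat \<Rightarrow> nat) \<Rightarrow> braid_letter \<Rightarrow> nat \<times> nat" where
  "over_under p (Sigma k) = (p (Suc k), p k)"
| "over_under p (Sigma_inv k) = (p k, p (Suc k))"

(* The crossings from top to bottom, each as the pair (over strand, under strand). *)
fun crossings_from :: "(nat \<Rightarrow> nat) \<Rightarrow> braid_letter list \<Rightarrow> (nat \<times> nat) list" where
  "crossings_from p [] = []"
| "crossings_from p (c # w) = over_under p c # crossings_from (cross_at (pos_of c) p) w"

definition crossings :: "braid \<Rightarrow> (nat \<times> nat) list" where
  "crossings B = crossings_from id (letters B)"

definition over_count :: "braid \<Rightarrow> nat \<Rightarrow> nat \<Rightarrow> nat" where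
  "over_count B a b = count_list (crossings B) (a, b)"

definition wd :: "braid \<Rightarrow> nat \<Rightarrow> nat \<Rightarrow> nat" where
  "wd B a b = over_count B b a"

(* Matrix indices start at 0, strand labels at 1. *)
definition OU_matrix :: "braid \<Rightarrow> (nat \<Rightarrow> nat) \<Rightarrow> int mat" where
  "OU_matrix B \<pi> = mat (width B) (width B)
     (\<lambda>(i, j). if i = j then 0 else int (over_count B (\<pi> (Suc i)) (\<pi> (Suc j))))"

(* By OU_det_eq below, every strand permutation gives the same value. *)
definition OU_det :: "braid \<Rightarrow> int" where
  "OU_det B = det (OU_matrix B id)"

lemma OU_det_eq:
  assumes "\<pi> permutes {1..width B}"
  shows "det (OU_matrix B \<pi>) = OU_det B"
proof -
  define n where "n = width B"
  define M where "M = OU_matrix B id"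
  define q where "q = (\<lambda>i. if i < n then \<pi> (Suc i) - 1 else i)"
  have p: "\<pi> permutes {1..n}" using assms by (simp add: n_def)
  have r: "1 \<le> \<pi> (Suc i) \<and> \<pi> (Suc i) \<le> n" if "i < n" for i
    using permutes_in_image[OF p, of "Suc i"] that by auto
  have qlt: "q i < n" if "i < n" for i using r[OF that] that by (auto simp: q_def)
  have qS: "Suc (q i) = \<pi> (Suc i)" if "i < n" for i using r[OF that] that by (auto simp: q_def)
  have inj: "inj_on q {0..<n}"
  proof (rule inj_onI)
    fix x y assume a: "x \<in> {0..<n}" "y \<in> {0..<n}" "q x = q y"
    then have "\<pi> (Suc x) = \<pi> (Suc y)" using qS by (metis atLeastLessThan_iff)
    then show "x = y" using permutes_inj[OF p] by (auto dest: injD)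
  qed
  have "q ` {0..<n} = {0..<n}"
    by (rule endo_inj_surj) (use qlt inj in auto)
  then have "bij_betw q {0..<n} {0..<n}" using inj by (simp add: bij_betw_def)
  then have q: "q permutes {0..<n}"
    by (rule bij_imp_permutes) (auto simp: q_def)
  have M: "M \<in> carrier_mat n n" by (simp add: M_def OU_matrix_def n_def)
  define R where "R = mat n n (\<lambda>(i, j). M $$ (q i, j))"
  have R: "R \<in> carrier_mat n n" by (simp add: R_def)
  have qeq: "q i = q j \<longleftrightarrow> i = j" if "i < n" "j < n" for i j
    using inj that by (auto simp: inj_on_def)
  have "transpose_mat (OU_matrix B \<pi>) = mat n n (\<lambda>(i, j). transpose_mat R $$ (q i, j))"
    by (rule eq_matI)
      (auto simp: OU_matrix_def R_def M_def n_def[symmetric] qlt qS qeq simp del: One_nat_def)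
  then have "det (transpose_mat (OU_matrix B \<pi>)) = signof q * det (transpose_mat R)"
    using det_permute_rows[OF _ q, of "transpose_mat R"] R by simp
  also have "\<dots> = signof q * (signof q * det M)"
    using det_transpose[OF R] det_permute_rows[OF M q] by (simp add: R_def)
  also have "\<dots> = det M" using signof_pm_one[of q, where 'a=int] by auto
  finally show ?thesis
    using det_transpose[of "OU_matrix B \<pi>" n]
    by (simp add: OU_det_def M_def OU_matrix_def n_def)
qed

fun set_pos :: "braid_letter \<Rightarrow> nat \<Rightarrow> braid_letter" where
  "set_pos (Sigma k) m = Sigma m"
| "set_pos (Sigma_inv k) m = Sigma_inv m"

(* Deleting the strands outside S leaves exactly the crossings between two strands of S.
   The left strand of such a crossing is then at the position given by its rank among the
   strands of S. *)
fun delete_strands :: "nat set \<Rightarrow> (nat \<Rightarrow> nat) \<Rightarrow> braid_letter list \<Rightarrow> braid_letter list" where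
  "delete_strands S p [] = []"
| "delete_strands S p (c # w) =
     (if p (pos_of c) \<in> S \<and> p (Suc (pos_of c)) \<in> S
      then [set_pos c (card {m \<in> {1..pos_of c}. p m \<in> S})] else [])
     @ delete_strands S (cross_at (pos_of c) p) w"

definition sub_braid :: "braid \<Rightarrow> nat set \<Rightarrow> braid" where
  "sub_braid B S = Braid (card S) (delete_strands S id (letters B))"

definition layered :: "braid \<Rightarrow> braid \<Rightarrow> braid \<Rightarrow> bool" where
  "layered B B1 B2 \<longleftrightarrow>
     (\<exists>S1 S2. S1 \<union> S2 = {1..width B} \<and> S1 \<inter> S2 = {} \<and> S1 \<noteq> {} \<and> S2 \<noteq> {}
        \<and> (\<forall>a\<in>S1. \<forall>b\<in>S2. wd B a b = 0)
        \<and> B1 = sub_braid B S1 \<and> B2 = sub_braid B S2)"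

lemma pos_of_set_pos [simp]: "pos_of (set_pos c m) = m"
  by (cases c) auto

lemma delete_strands_pos:
  assumes "p permutes {1..n}" "S \<subseteq> {1..n}" "\<forall>c\<in>set w. 1 \<le> pos_of c \<and> pos_of c < n"
    "d \<in> set (delete_strands S p w)"
  shows "1 \<le> pos_of d \<and> pos_of d < card S"
  using assms
proof (induction w arbitrary: p)
  case Nil
  then show ?case by simp
next
  case (Cons c w)
  let ?k = "pos_of c"
  have k: "1 \<le> ?k" "?k < n" using Cons.prems by auto
  have "Transposition.transpose ?k (Suc ?k) permutes {1..n}"
    using k by (intro permutes_swap_id) auto
  then have p': "cross_at ?k p permutes {1..n}"
    unfolding cross_at_def using Cons.prems(1) by (rule permutes_compose)
  show ?case
  proof (cases "d \<in> set (delete_strands S (cross_at ?k p) w)")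
    case True
    then show ?thesis using Cons.IH[OF p'] Cons.prems by auto
  next
    case False
    let ?A = "{m \<in> {1..?k}. p m \<in> S}"
    have in_S: "p ?k \<in> S" "p (Suc ?k) \<in> S" and d: "pos_of d = card ?A"
      using False Cons.prems(4) by (auto split: if_splits)
    have fS: "finite S" using Cons.prems(2) finite_subset by blast
    have "?k \<in> ?A" using in_S k by auto
    then have "card ?A > 0" by (subst card_gt_0_iff) auto
    moreover have "card ?A < card S"
    proof -
      have "p (Suc ?k) \<notin> p ` ?A"
        by (simp add: inj_image_mem_iff[OF permutes_inj[OF Cons.prems(1)]])
      then have "p ` ?A \<subset> S" using in_S(2) by blast
      then have "card (p ` ?A) < card S" using fS by (rule psubset_card_mono[rotated])
      then show ?thesis
        using card_image[OF inj_on_subset[OF permutes_inj[OF Cons.prems(1)] subset_UNIV], of ?A]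
        by linarith
    qed
    ultimately show ?thesis unfolding d by linarith
  qed
qed

lemma braid_diagram_sub_braid:
  assumes "braid_diagram B" "S \<subseteq> {1..width B}" "S \<noteq> {}"
  shows "braid_diagram (sub_braid B S)"
proof -
  have "card S \<ge> 1" using assms
    by (metis One_nat_def Suc_leI card_gt_0_iff finite_atLeastAtMost finite_subset)
  moreover have "1 \<le> pos_of d \<and> pos_of d < card S"
    if "d \<in> set (delete_strands S id (letters B))" for d
    using delete_strands_pos[OF permutes_id assms(2) _ that] assms(1)
    unfolding braid_diagram_def by blast
  ultimately show ?thesis
    unfolding braid_diagram_def sub_braid_def braid.sel by blast
qed

end

theory Submission
  imports Defs
begin

text \<open>List the strands of \<open>S1\<close> before those of \<open>S2\<close>. No strand of \<open>S2\<close> passes over a strand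
  of \<open>S1\<close>, so the OU matrix in this order is block upper triangular. Its diagonal blocks are the
  OU matrices of the two layers, because deleting strands keeps the crossings among the remaining
  strands and relabels every strand by its rank.\<close>

text \<open>The expression by which \<open>delete_strands\<close> places a kept crossing. With the
  arrangement \<open>id\<close> it is also the new label that a strand of \<open>S\<close> receives
  in the sub-braid.\<close>

definition rank_in :: "nat set \<Rightarrow> (nat \<Rightarrow> nat) \<Rightarrow> nat \<Rightarrow> nat" where
  "rank_in S p m = card {x \<in> {1..m}. p x \<in> S}"

lemma rank_in_0 [simp]: "rank_in S p 0 = 0"
  by (simp add: rank_in_def)

lemma rank_in_Suc: "rank_in S p (Suc m) = rank_in S p m + (if p (Suc m) \<in> S then 1 else 0)"
proof -
  have "{x \<in> {1..Suc m}. p x \<in> S} =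
      (if p (Suc m) \<in> S then insert (Suc m) {x \<in> {1..m}. p x \<in> S} else {x \<in> {1..m}. p x \<in> S})"
    by (auto simp: le_Suc_eq)
  then show ?thesis by (simp add: rank_in_def)
qed

lemma rank_in_mono: "m \<le> m' \<Longrightarrow> rank_in S p m \<le> rank_in S p m'"
  by (induction m' rule: dec_induct) (auto simp: rank_in_Suc)

lemma rank_in_less:
  assumes "m < m'" "p m' \<in> S"
  shows "rank_in S p m < rank_in S p m'"
proof -
  obtain l where l: "m' = Suc l" "m \<le> l" using assms(1) by (cases m') auto
  then show ?thesis using rank_in_mono[OF l(2), of S p] assms(2) by (simp add: rank_in_Suc)
qed

lemma rank_in_inj:
  assumes "p m \<in> S" "p m' \<in> S" "rank_in S p m = rank_in S p m'"
  shows "m = m'"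
  using rank_in_less[of m m' p S] rank_in_less[of m' m p S] assms
  by (cases m m' rule: linorder_cases) auto

lemma cross_at_simps [simp]:
  "cross_at k p k = p (Suc k)"
  "cross_at k p (Suc k) = p k"
  "m \<noteq> k \<Longrightarrow> m \<noteq> Suc k \<Longrightarrow> cross_at k p m = p m"
  by (simp_all add: cross_at_def)

text \<open>Swapping positions \<open>k\<close> and \<open>Suc k\<close> alters the set of strands
  on positions 1 to \<open>m\<close> only if \<open>m\<close> separates the two. For
  \<open>k = 0\<close> this would fail, since position 0 is not counted.\<close>

lemma rank_in_cross_at:
  assumes "1 \<le> k" "m \<noteq> k"
  shows "rank_in S (cross_at k p) m = rank_in S p m"
proof -
  obtain l where l: "k = Suc l" using assms(1) by (cases k) auto
  have low: "rank_in S (cross_at k p) m = rank_in S p m" if "m < k" for m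
    using that by (induction m) (auto simp: rank_in_Suc)
  have high: "rank_in S (cross_at k p) m = rank_in S p m" if "Suc k \<le> m" for m
    using that
  proof (induction m rule: dec_induct)
    case base
    \<comment> \<open>Below \<open>k\<close> nothing moved, and the contributions of positions
      \<open>k\<close> and \<open>Suc k\<close> are merely added in the other order.\<close>
    show ?case using low[of l] by (simp add: rank_in_Suc l cross_at_simps[of "Suc l"])
  next
    case (step m)
    then show ?case by (simp add: rank_in_Suc)
  qed
  show ?thesis using low[of m] high[of m] assms(2) by linarith
qed

text \<open>The remaining case \<open>m = k\<close>: both sides are the rank at
  \<open>Suc k\<close>, which the swap preserves, with its last contribution split off.\<close>

lemma rank_in_cross_at_same:
  assumes "1 \<le> k"
  shows "rank_in S (cross_at k p) k + (if p k \<in> S then 1 else 0)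
    = rank_in S p k + (if p (Suc k) \<in> S then 1 else 0)"
  using rank_in_cross_at[OF assms, of "Suc k" S p] by (simp add: rank_in_Suc)

text \<open>The arrangement \<open>q\<close> is the one reached in the sub-braid when \<open>p\<close> is reached in the braid.\<close>

lemma crossings_from_delete_strands:
  assumes "\<forall>c\<in>set w. 1 \<le> pos_of c"
    and "\<And>m. 1 \<le> m \<Longrightarrow> p m \<in> S \<Longrightarrow> q (rank_in S p m) = f (p m)"
  shows "crossings_from q (delete_strands S p w)
    = map (map_prod f f) (filter (\<lambda>(a, b). a \<in> S \<and> b \<in> S) (crossings_from p w))"
  using assms
proof (induction w arbitrary: p q)
  case Nil
  then show ?case by simp
next
  case (Cons c w)
  define k where "k = pos_of c"
  have k: "1 \<le> k" and w: "\<forall>c\<in>set w. 1 \<le> pos_of c" using Cons.prems(1) by (auto simp: k_def)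
  note inv = Cons.prems(2)
  let ?r = "rank_in S p" and ?p' = "cross_at k p"
  note same = rank_in_cross_at_same[OF k, of S p]
  note other = rank_in_cross_at[OF k, of _ S p]
  show ?case
  proof (cases "p k \<in> S \<and> p (Suc k) \<in> S")
    case True
    have rS: "?r (Suc k) = Suc (?r k)" using True by (simp add: rank_in_Suc)
    have qk: "q (?r k) = f (p k)" "q (Suc (?r k)) = f (p (Suc k))"
      using inv[of k] inv[of "Suc k"] True k rS by auto
    \<comment> \<open>The two strands are neighbours in the sub-braid as well, at ranks
      \<open>?r k\<close> and \<open>Suc (?r k)\<close>, so the kept letter swaps exactly their
      images.\<close>
    have "cross_at (?r k) q (rank_in S ?p' m) = f (?p' m)" if m: "1 \<le> m" "?p' m \<in> S" for m
    proof -
      consider "m = k" | "m = Suc k" | "m \<noteq> k" "m \<noteq> Suc k" by blast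
      then show ?thesis
      proof cases
        case 1
        then show ?thesis using same True qk by simp
      next
        case 2
        then show ?thesis using other[of "Suc k"] rS qk by simp
      next
        case 3
        then have pm: "p m \<in> S" using m by simp
        \<comment> \<open>Any other strand of \<open>S\<close> has a rank different from these two,
          so the swap in \<open>q\<close> does not move it.\<close>
        have "?r m \<noteq> ?r k" "?r m \<noteq> Suc (?r k)"
          using rank_in_inj[of p m S k] rank_in_inj[of p m S "Suc k"] pm True 3 rS by auto
        then show ?thesis using 3 other[of m] inv[of m] pm m by simp
      qed
    qed
    from Cons.IH[where p = ?p' and q = "cross_at (?r k) q", OF w this] show ?thesis
      using True qk by (cases c) (auto simp: k_def rank_in_def)
  next
    case False
    \<comment> \<open>No letter is emitted and \<open>q\<close> stays. A strand of \<open>S\<close>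
      that passes a deleted strand changes its position but not its rank.\<close>
    have "q (rank_in S ?p' m) = f (?p' m)" if m: "1 \<le> m" "?p' m \<in> S" for m
    proof -
      consider "m = k" | "m = Suc k" | "m \<noteq> k" "m \<noteq> Suc k" by blast
      then show ?thesis
      proof cases
        case 1
        then show ?thesis using same False m inv[of "Suc k"] by (simp add: rank_in_Suc)
      next
        case 2
        then show ?thesis using other[of "Suc k"] False m k inv[of k] by (simp add: rank_in_Suc)
      next
        case 3
        then show ?thesis using other[of m] inv[of m] m by simp
      qed
    qed
    from Cons.IH[where p = ?p' and q = q, OF w this] show ?thesis
      using False by (cases c) (auto simp: k_def)
  qed
qed

lemma bij_betw_rank_in:
  assumes "S \<subseteq> {1..n}"
  shows "bij_betw (rank_in S id) S {1..card S}"
proof -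
  have fin: "finite S" using assms finite_subset by blast
  have inj: "inj_on (rank_in S id) S" by (rule inj_onI) (auto intro: rank_in_inj[of id _ S])
  have "rank_in S id a \<in> {1..card S}" if a: "a \<in> S" for a
  proof -
    have "rank_in S id 0 < rank_in S id a" by (rule rank_in_less) (use a assms in auto)
    moreover have "rank_in S id a \<le> card S"
      unfolding rank_in_def by (rule card_mono[OF fin]) auto
    ultimately show ?thesis by simp
  qed
  \<comment> \<open>An injective image of \<open>S\<close> inside a set of \<open>card S\<close>
    elements fills that set.\<close>
  then have "rank_in S id ` S = {1..card S}"
    by (intro card_subset_eq) (auto simp: card_image[OF inj])
  then show ?thesis using inj by (simp add: bij_betw_def)
qed

text \<open>The filter drops no copy of \<open>(a, b)\<close>, and by injectivity no other kept pair
  has the same image.\<close>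

lemma count_list_map_prod_filter:
  assumes "inj_on f S" "a \<in> S" "b \<in> S"
  shows "count_list (map (map_prod f f) (filter (\<lambda>(a, b). a \<in> S \<and> b \<in> S) xs)) (f a, f b)
    = count_list xs (a, b)"
  using assms by (induction xs) (auto simp: inj_on_eq_iff)

lemma over_count_sub_braid:
  assumes "braid_diagram B" "S \<subseteq> {1..width B}" "a \<in> S" "b \<in> S"
  shows "over_count (sub_braid B S) (rank_in S id a) (rank_in S id b) = over_count B a b"
proof -
  \<comment> \<open>At the top both arrangements are \<open>id\<close> and the relabelling is the
    rank itself, so the invariant between \<open>p\<close> and \<open>q\<close> is trivial
    there.\<close>
  have "crossings (sub_braid B S) = map (map_prod (rank_in S id) (rank_in S id))
      (filter (\<lambda>(a, b). a \<in> S \<and> b \<in> S) (crossings B))"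
    unfolding crossings_def sub_braid_def braid.sel
    by (rule crossings_from_delete_strands) (use assms(1) in \<open>auto simp: braid_diagram_def\<close>)
  then show ?thesis
    using count_list_map_prod_filter[OF bij_betw_imp_inj_on[OF bij_betw_rank_in[OF assms(2)]]] assms
    by (simp add: over_count_def)
qed

text \<open>Recovers the original strand from its label in the sub-braid, so that entries of the
  smaller matrix can be read as counts in \<open>B\<close>.\<close>

definition nth_strand :: "nat set \<Rightarrow> nat \<Rightarrow> nat" where
  "nth_strand S = inv_into S (rank_in S id)"

lemma bij_betw_nth_strand: "S \<subseteq> {1..n} \<Longrightarrow> bij_betw (nth_strand S) {1..card S} S"
  unfolding nth_strand_def by (intro bij_betw_inv_into bij_betw_rank_in)

lemma rank_in_nth_strand:
  "S \<subseteq> {1..n} \<Longrightarrow> i \<in> {1..card S} \<Longrightarrow> rank_in S id (nth_strand S i) = i"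
  unfolding nth_strand_def by (rule bij_betw_inv_into_right[OF bij_betw_rank_in])

lemma OU_matrix_sub_braid:
  assumes "braid_diagram B" "S \<subseteq> {1..width B}"
  shows "OU_matrix (sub_braid B S) id = mat (card S) (card S) (\<lambda>(i, j).
    if i = j then 0 else int (over_count B (nth_strand S (Suc i)) (nth_strand S (Suc j))))"
proof -
  have width: "width (sub_braid B S) = card S" by (simp add: sub_braid_def)
  have "over_count (sub_braid B S) (Suc i) (Suc j)
      = over_count B (nth_strand S (Suc i)) (nth_strand S (Suc j))"
    if "i < card S" "j < card S" for i j
  proof -
    have ij: "Suc i \<in> {1..card S}" "Suc j \<in> {1..card S}" using that by auto
    note bij = bij_betw_nth_strand[OF assms(2)]
    show ?thesis
      using over_count_sub_braid[OF assms bij_betw_apply[OF bij ij(1)] bij_betw_apply[OF bij ij(2)]]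
      by (simp only: rank_in_nth_strand[OF assms(2) ij(1)] rank_in_nth_strand[OF assms(2) ij(2)])
  qed
  then show ?thesis
    by (intro eq_matI) (auto simp: OU_matrix_def width)
qed

theorem theorem1:
  fixes B B1 B2 :: braid
  assumes "braid_diagram B" and "layered B B1 B2"
  shows "OU_det B = OU_det B1 * OU_det B2"
proof -
  \<comment> \<open>Since \<open>wd\<close> counts passages under, the layering condition turns into
    a vanishing \<open>over_count\<close> with its arguments exchanged.\<close>
  obtain S1 S2 where S: "S1 \<union> S2 = {1..width B}" "S1 \<inter> S2 = {}"
    and wd: "\<And>a b. a \<in> S1 \<Longrightarrow> b \<in> S2 \<Longrightarrow> over_count B b a = 0"
    and B1: "B1 = sub_braid B S1" and B2: "B2 = sub_braid B S2"
    using assms(2) unfolding layered_def wd_def by blast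
  have sub: "S1 \<subseteq> {1..width B}" "S2 \<subseteq> {1..width B}" using S by auto
  define n1 n2 where "n1 = card S1" and "n2 = card S2"
  have fin: "finite S1" "finite S2" using sub by (blast intro: finite_subset)+
  have n: "width B = n1 + n2"
    using card_Un_disjoint[OF fin S(2)] unfolding S(1) n1_def n2_def
    by (simp only: card_atLeastAtMost diff_Suc_1 One_nat_def)
  define g1 g2 where "g1 = nth_strand S1" and "g2 = nth_strand S2"
  have bij: "bij_betw g1 {1..n1} S1" "bij_betw g2 {1..n2} S2"
    unfolding g1_def g2_def n1_def n2_def using sub by (blast intro: bij_betw_nth_strand)+
  \<comment> \<open>The listing of \<open>S1\<close> followed by that of \<open>S2\<close>; the last
    branch fixes everything else, as \<open>permutes\<close> demands.\<close>
  define \<pi> where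
    "\<pi> i = (if i \<in> {1..n1} then g1 i else if i \<in> {n1+1..n1+n2} then g2 (i - n1) else i)" for i
  have shift: "bij_betw (\<lambda>i. i - n1) {n1+1..n1+n2} {1..n2}"
    by (rule bij_betw_byWitness[where f' = "\<lambda>i. i + n1"]) auto
  have "bij_betw \<pi> {1..n1} S1"
    using bij(1) by (subst bij_betw_cong[of _ _ g1]) (auto simp: \<pi>_def)
  moreover have "bij_betw \<pi> {n1+1..n1+n2} S2"
    using bij_betw_trans[OF shift bij(2)]
    by (subst bij_betw_cong[of _ _ "g2 \<circ> (\<lambda>i. i - n1)"]) (auto simp: \<pi>_def)
  ultimately have "bij_betw \<pi> ({1..n1} \<union> {n1+1..n1+n2}) (S1 \<union> S2)"
    using S(2) by (rule bij_betw_combine)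
  moreover have "{1..n1} \<union> {n1+1..n1+n2} = {1..width B}" by (auto simp: n)
  ultimately have \<pi>: "\<pi> permutes {1..width B}"
    unfolding S(1) by (intro bij_imp_permutes) (auto simp: \<pi>_def n)
  have \<pi>1: "\<pi> (Suc i) = g1 (Suc i)" if "i < n1" for i using that by (simp add: \<pi>_def)
  \<comment> \<open>Matrix indices start at 0 and labels at 1; \<open>n1 \<le> i\<close> lets the
    truncated subtraction commute with \<open>Suc\<close>.\<close>
  have \<pi>2: "\<pi> (Suc i) = g2 (Suc (i - n1))" if "n1 \<le> i" "i < n1 + n2" for i
    using that by (simp add: \<pi>_def Suc_diff_le)
  \<comment> \<open>The upper right block needs no exception for \<open>i = j\<close>: its rows and
    columns belong to different strands.\<close>
  define C where "C = mat n1 n2 (\<lambda>(i, j). int (over_count B (g1 (Suc i)) (g2 (Suc j))))"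
  have M1: "OU_matrix B1 id = mat n1 n1
      (\<lambda>(i, j). if i = j then 0 else int (over_count B (g1 (Suc i)) (g1 (Suc j))))"
    unfolding B1 g1_def n1_def by (rule OU_matrix_sub_braid[OF assms(1) sub(1)])
  have M2: "OU_matrix B2 id = mat n2 n2
      (\<lambda>(i, j). if i = j then 0 else int (over_count B (g2 (Suc i)) (g2 (Suc j))))"
    unfolding B2 g2_def n2_def by (rule OU_matrix_sub_braid[OF assms(1) sub(2)])
  \<comment> \<open>The lower left block, with rows from \<open>S2\<close> and columns from
    \<open>S1\<close>.\<close>
  have zero: "over_count B (g2 (Suc i)) (g1 (Suc j)) = 0" if "i < n2" "j < n1" for i j
    using that by (intro wd bij_betw_apply[OF bij(1)] bij_betw_apply[OF bij(2)]) auto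
  have "OU_matrix B \<pi> = four_block_mat (OU_matrix B1 id) C (0\<^sub>m n2 n1) (OU_matrix B2 id)"
    unfolding M1 M2
    by (rule eq_matI) (auto simp: OU_matrix_def n C_def \<pi>1 \<pi>2 zero)
  then have "det (OU_matrix B \<pi>) = det (OU_matrix B1 id) * det (OU_matrix B2 id)"
    by (simp add: det_four_block_mat_lower_left_zero[of _ n1 _ n2] M1 M2 C_def)
  \<comment> \<open>The chosen order of the strands does not affect the determinant.\<close>
  then show ?thesis using OU_det_eq[OF \<pi>] by (simp add: OU_det_def)
qed

end
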